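(* Let $(J,R,Q,B)\in\Sigma_{n,m}$ and $S\in\mathbb{K}^{m\times m}$ with $S^H=S\ge0$. The pencil $s\mathcal{E}-\mathcal{A}_S$ is regular if and only if there exists $\omega\in\mathbb{R}$ such that $$i\omega\notin\sigma(JQ)\quad\text{and}\quad B\ker S\cap(JQ-i\omega I)\ker RQ=\{0\}=\ker B\cap\ker S.$$
   Context: $\mathbb{K}\in\{\mathbb{R},\mathbb{C}\}$, $n,m$ are positive integers, $A^H$ is the conjugate transpose, $\sigma(A)$ is the set of (complex) eigenvalues of a square matrix $A$, and $A\ge0$ means $x^HAx\ge0$ for all $x$. $\Sigma_{n,m}$ is the set of all $(J,R,Q,B)\in(\mathbb{K}^{n\times n})^3\times\mathbb{K}^{n\times m}$ with $J=-J^H$, $R=R^H\ge0$, $Q=Q^H\ge0$. The optimality pencil $s\mathcal{E}-\mathcal{A}_S$ has coefficients $$\mathcal{E}=\begin{bmatrix}0_{n\times n}&I_n&0_{n\times m}\\-I_n&0_{n\times n}&0_{n\times m}\\0_{m\times n}&0_{m\times n}&0_{m\times m}\end{bmatrix},\qquad \mathcal{A}_S=\begin{bmatrix}0_{n\times n}&(J-R)Q&B\\((J-R)Q)^H&QRQ&0_{n\times m}\\ B^H&0_{m\times n}&S\end{bmatrix}.$$ It is called regular if $\det(s\mathcal{E}-\mathcal{A}_S)$ is not the zero polynomial in $s$. For a matrix $M$ and a subspace $W$, $MW$ denotes the image of $W$ under $M$. If $\mathbb{K}=\mathbb{R}$, kernels and images in expressions involving $i\omega$ are taken over $\mathbb{C}$.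 *)

theory Defs
  imports
    "Jordan_Normal_Form.Spectral_Radius"
    "Jordan_Normal_Form.Schur_Decomposition"
    "Jordan_Normal_Form.Matrix_Kernel"
begin

text \<open>
  The two cases \<open>\<K> = \<real>\<close> and \<open>\<K> = \<complex>\<close> are treated at once: \<open>K\<close> is a set of complex
  numbers, either \<^term>\<open>\<real> :: complex set\<close> or \<^term>\<open>UNIV :: complex set\<close>, and a matrix or
  vector over \<open>\<K>\<close> is a complex matrix or vector all of whose entries lie in \<open>K\<close>.
\<close>

definition vec_over :: "complex set \<Rightarrow> nat \<Rightarrow> complex vec set" where
  "vec_over K n = {x \<in> carrier_vec n. vec_set x \<subseteq> K}"

definition mat_over :: "complex set \<Rightarrow> nat \<Rightarrow> nat \<Rightarrow> complex mat set" where
  "mat_over K r c = {A \<in> carrier_mat r c. elements_mat A \<subseteq> K}"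

definition ker_over :: "complex set \<Rightarrow> complex mat \<Rightarrow> complex vec set" where
  "ker_over K A = mat_kernel A \<inter> vec_over K (dim_col A)"

text \<open>
  \<open>0 \<le> z\<close> for complex \<open>z\<close> means that \<open>z\<close> is real and nonnegative (\<open>HOL-Library.Complex_Order\<close>).
\<close>

definition psd_over :: "complex set \<Rightarrow> complex mat \<Rightarrow> bool" where
  "psd_over K A \<longleftrightarrow> (\<forall>x \<in> vec_over K (dim_row A). 0 \<le> conjugate x \<bullet> (A *\<^sub>v x))"

definition Sigma_set ::
  "complex set \<Rightarrow> nat \<Rightarrow> nat \<Rightarrow> (complex mat \<times> complex mat \<times> complex mat \<times> complex mat) set"
where
  "Sigma_set K n m =
    {(J, R, Q, B).
       J \<in> mat_over K n n \<and> R \<in> mat_over K n n \<and> Q \<in> mat_over K n n \<and> B \<in> mat_over K n m \<and>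
       J = - mat_adjoint J \<and>
       R = mat_adjoint R \<and> psd_over K R \<and>
       Q = mat_adjoint Q \<and> psd_over K Q}"

text \<open>Horizontal concatenation, the counterpart of \<^const>\<open>append_rows\<close>.\<close>

definition append_cols :: "'a :: zero mat \<Rightarrow> 'a mat \<Rightarrow> 'a mat" (infixr \<open>@\<^sub>c\<close> 66) where
  "A @\<^sub>c B = four_block_mat A B (0\<^sub>m 0 (dim_col A)) (0\<^sub>m 0 (dim_col B))"

definition pencil_E :: "nat \<Rightarrow> nat \<Rightarrow> complex mat" where
  "pencil_E n m =
     (0\<^sub>m n n      @\<^sub>c  1\<^sub>m n    @\<^sub>c  0\<^sub>m n m) @\<^sub>r
     ((- (1\<^sub>m n))  @\<^sub>c  0\<^sub>m n n  @\<^sub>c  0\<^sub>m n m) @\<^sub>r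
     (0\<^sub>m m n      @\<^sub>c  0\<^sub>m m n  @\<^sub>c  0\<^sub>m m m)"

definition pencil_A ::
  "nat \<Rightarrow> nat \<Rightarrow> complex mat \<Rightarrow> complex mat \<Rightarrow> complex mat \<Rightarrow> complex mat \<Rightarrow> complex mat \<Rightarrow> complex mat"
where
  "pencil_A n m J R Q B S =
     (0\<^sub>m n n                      @\<^sub>c  (J - R) * Q  @\<^sub>c  B)       @\<^sub>r
     (mat_adjoint ((J - R) * Q)  @\<^sub>c  Q * R * Q    @\<^sub>c  0\<^sub>m n m) @\<^sub>r
     (mat_adjoint B              @\<^sub>c  0\<^sub>m m n      @\<^sub>c  S)"

text \<open>The matrix \<open>s E - A\<close> over the polynomial ring in the indeterminate \<open>s\<close>.\<close>

definition pencil :: "complex mat \<Rightarrow> complex mat \<Rightarrow> complex poly mat" where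
  "pencil E A = [:0, 1:] \<cdot>\<^sub>m map_mat (\<lambda>a. [:a:]) E - map_mat (\<lambda>a. [:a:]) A"

definition regular_pencil :: "complex mat \<Rightarrow> complex mat \<Rightarrow> bool" where
  "regular_pencil E A \<longleftrightarrow> det (pencil E A) \<noteq> 0"

end

theory Submission
  imports Defs
begin

text \<open>
  The determinant of the pencil is a polynomial, so the pencil is regular if and only if the complex
  matrix \<open>s E - A\<close> is nonsingular for some \<open>s\<close>, and then it is nonsingular for all but finitely many
  \<open>s\<close>. Only points \<open>s = i \<omega>\<close> of the imaginary axis are needed. With \<open>W = (J - R) Q\<close>, a block vector
  \<open>(x, y, u)\<close> lies in the kernel of \<open>s E - A\<close> if and only if
  \<open>s y = W y + B u\<close>, \<open>- s x = W\<^sup>H x + Q R Q y\<close> and \<open>0 = B\<^sup>H x + S u\<close>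
  (\<open>pencil_kernel_iff\<close>).

  If the pencil is regular, choose \<open>\<omega>\<close> such that \<open>i \<omega>\<close> is neither a root of the determinant nor an
  eigenvalue of \<open>J Q\<close>. If \<open>B u = (J Q - i \<omega>) y\<close> with \<open>S u = 0\<close> and \<open>R Q y = 0\<close>, then \<open>W y = J Q y\<close>,
  so \<open>(0, y, - u)\<close> is in the kernel and therefore zero. Likewise, if \<open>B u = 0\<close> and \<open>S u = 0\<close>, then
  \<open>(0, 0, u)\<close> is in the kernel.

  Conversely, let \<open>\<omega>\<close> be as in the condition and let \<open>(x, y, u)\<close> be in the kernel at \<open>s = i \<omega>\<close>.
  Since \<open>- s\<close> is the conjugate of \<open>s\<close>, pairing the first equation with \<open>x\<close>, the second with \<open>y\<close> and
  the third with \<open>u\<close> makes everything cancel except the energy balance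
  \<open>(Q y)\<^sup>H R (Q y) + u\<^sup>H S u = 0\<close>. Both terms are nonnegative, hence \<open>R Q y = 0\<close> and
  \<open>S u = 0\<close> (\<open>psd_form_zero\<close>). The first equation becomes \<open>B u = - (J Q - i \<omega>) y\<close>, and the condition
  on the intersection gives \<open>B u = 0\<close>. So \<open>u = 0\<close> by the condition on the kernels and \<open>y = 0\<close> because
  \<open>i \<omega>\<close> is no eigenvalue of \<open>J Q\<close>. What remains is \<open>W\<^sup>H x = - i \<omega> x\<close>. Here \<open>i \<omega>\<close> is no eigenvalue
  of \<open>W\<close> either, since an imaginary eigenvalue leaves no room for dissipation and every eigenvector for
  it is one of \<open>J Q\<close> (\<open>dissipative_imaginary_eigenvector\<close>), so \<open>x = 0\<close>
  (\<open>adjoint_eigenvector_trivial\<close>).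

  For \<open>K = \<real>\<close>, positivity and the triviality of \<open>ker B \<inter> ker S\<close> are assumed over the reals while the
  argument takes place over \<open>\<complex>\<close>. Splitting vectors into real and imaginary parts bridges the gap
  (\<open>psd_complexification\<close>, \<open>common_kernel_trivial_complexification\<close>).
\<close>

section \<open>Adjoints and the Hermitian inner product\<close>

lemma mat_over_carrier: "A \<in> mat_over K r c \<Longrightarrow> A \<in> carrier_mat r c"
  by (simp add: mat_over_def)

lemma mat_adjoint_carrier [simp]:
  "A \<in> carrier_mat r c \<Longrightarrow> mat_adjoint A \<in> carrier_mat c r"
  unfolding mat_adjoint_def by auto

lemma dim_mat_adjoint [simp]:
  "dim_row (mat_adjoint A) = dim_col A" "dim_col (mat_adjoint A) = dim_row A"
  unfolding mat_adjoint_def by auto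

lemma index_mat_adjoint:
  "A \<in> carrier_mat r c \<Longrightarrow> i < c \<Longrightarrow> j < r \<Longrightarrow> mat_adjoint A $$ (i, j) = conjugate (A $$ (j, i))"
  unfolding mat_adjoint_def by (auto simp: mat_of_rows_def)

lemma cscalar_prod_adjoint:
  fixes A :: "complex mat"
  assumes A: "A \<in> carrier_mat r c" and v: "v \<in> carrier_vec c" and w: "w \<in> carrier_vec r"
  shows "(A *\<^sub>v v) \<bullet>c w = v \<bullet>c (mat_adjoint A *\<^sub>v w)"
proof -
  have "(A *\<^sub>v v) \<bullet>c w = (\<Sum>i<r. \<Sum>j<c. A $$ (i, j) * v $ j * cnj (w $ i))"
    using A v w by (auto simp: scalar_prod_def lessThan_atLeast0 sum_distrib_right
        mult_mat_vec_def conjugate_complex_def intro!: sum.cong)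
  also have "\<dots> = (\<Sum>j<c. \<Sum>i<r. A $$ (i, j) * v $ j * cnj (w $ i))"
    by (rule sum.swap)
  also have "\<dots> = v \<bullet>c (mat_adjoint A *\<^sub>v w)"
    using A v w index_mat_adjoint[OF A]
    by (auto simp: scalar_prod_def lessThan_atLeast0 sum_distrib_left index_row
        mult_mat_vec_def conjugate_complex_def ac_simps intro!: sum.cong)
  finally show ?thesis .
qed

lemma conjugate_cscalar_prod:
  fixes v w :: "complex vec"
  assumes "v \<in> carrier_vec n" and "w \<in> carrier_vec n"
  shows "cnj (v \<bullet>c w) = w \<bullet>c v"
  using assms by (simp add: scalar_prod_def conjugate_complex_def ac_simps)

lemma cscalar_prod_smult_right:
  fixes v w :: "complex vec"
  assumes "v \<in> carrier_vec n" and "w \<in> carrier_vec n"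
  shows "v \<bullet>c (c \<cdot>\<^sub>v w) = cnj c * (v \<bullet>c w)"
  using assms by (simp add: conjugate_smult_vec conjugate_complex_def)

lemma cscalar_prod_uminus_right:
  fixes v w :: "complex vec"
  assumes "v \<in> carrier_vec n" and "w \<in> carrier_vec n"
  shows "v \<bullet>c (- w) = - (v \<bullet>c w)"
  using assms by (simp add: uminus_conjugate_vec[symmetric])

lemma cscalar_prod_add_right:
  fixes v w :: "complex vec"
  assumes "v \<in> carrier_vec n" and "w \<in> carrier_vec n" and "z \<in> carrier_vec n"
  shows "v \<bullet>c (w + z) = v \<bullet>c w + v \<bullet>c z"
  using assms by (simp add: conjugate_add_vec scalar_prod_add_distrib[of _ n])

lemma cscalar_prod_add_smult_left:
  fixes v w z :: "complex vec"
  assumes "v \<in> carrier_vec n" and "w \<in> carrier_vec n" and "z \<in> carrier_vec n"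
  shows "(v + c \<cdot>\<^sub>v w) \<bullet>c z = v \<bullet>c z + c * (w \<bullet>c z)"
  using assms by (simp add: add_scalar_prod_distrib[of _ n])

text \<open>
  The quadratic form of \<^const>\<open>psd_over\<close> has the conjugated vector on the left, whereas
  \<open>\<bullet>c\<close> conjugates its right argument.
\<close>

lemma psd_form_eq:
  fixes A :: "complex mat"
  assumes "A \<in> carrier_mat n n" and "x \<in> carrier_vec n"
  shows "conjugate x \<bullet> (A *\<^sub>v x) = (A *\<^sub>v x) \<bullet>c x"
  by (rule comm_scalar_prod[of _ n]) (use assms in auto)

text \<open>
  With \<open>g = A x\<close>, the form at \<open>x + t g\<close> equals \<open>2 t |g|\<^sup>2 + t\<^sup>2 g\<^sup>H A g\<close> for real \<open>t\<close>. If \<open>g\<close>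
  were not zero, this would be negative for small negative \<open>t\<close>.
\<close>

lemma psd_form_zero:
  fixes A :: "complex mat"
  assumes A [simp]: "A \<in> carrier_mat n n" and sym: "mat_adjoint A = A"
    and psd: "\<And>x. x \<in> carrier_vec n \<Longrightarrow> 0 \<le> (A *\<^sub>v x) \<bullet>c x"
    and x [simp]: "x \<in> carrier_vec n" and zero: "Re ((A *\<^sub>v x) \<bullet>c x) = 0"
  shows "A *\<^sub>v x = 0\<^sub>v n"
proof -
  define g where "g = A *\<^sub>v x"
  have g [simp]: "g \<in> carrier_vec n" unfolding g_def by (rule mult_mat_vec_carrier[OF A x])
  define N where "N = Re (g \<bullet>c g)"
  define c where "c = Re ((A *\<^sub>v g) \<bullet>c g)"
  have gg: "g \<bullet>c g = complex_of_real N"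
    using conjugate_square_ge_0_vec[of g] by (simp add: N_def less_eq_complex_def complex_eq_iff)
  have c0: "c \<ge> 0" using psd[OF g] by (simp add: c_def less_eq_complex_def)
  have quad: "0 \<le> 2 * t * N + t * t * c" for t :: real
  proof -
    let ?y = "x + complex_of_real t \<cdot>\<^sub>v g"
    have Ay: "A *\<^sub>v ?y = g + complex_of_real t \<cdot>\<^sub>v (A *\<^sub>v g)"
      using mult_mat_vec[OF A g, of "complex_of_real t"]
      by (simp add: mult_add_distrib_mat_vec[of A n n] flip: g_def)
    have Ag [simp]: "A *\<^sub>v g \<in> carrier_vec n" by (rule mult_mat_vec_carrier[OF A g])
    have sx: "(A *\<^sub>v g) \<bullet>c x = g \<bullet>c g"
      using cscalar_prod_adjoint[OF A g x] sym by (simp flip: g_def)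
    have "(A *\<^sub>v ?y) \<bullet>c ?y = g \<bullet>c ?y + complex_of_real t * ((A *\<^sub>v g) \<bullet>c ?y)"
      unfolding Ay by (rule cscalar_prod_add_smult_left[OF g Ag]) simp
    also have "\<dots> = g \<bullet>c x + 2 * complex_of_real t * (g \<bullet>c g)
        + complex_of_real t * complex_of_real t * ((A *\<^sub>v g) \<bullet>c g)"
      by (simp add: cscalar_prod_add_right[of _ n] cscalar_prod_smult_right[of _ n] sx
          algebra_simps)
    finally have "Re ((A *\<^sub>v ?y) \<bullet>c ?y) = 2 * t * N + t * t * c"
      using zero by (simp add: gg c_def flip: g_def)
    moreover have "0 \<le> Re ((A *\<^sub>v ?y) \<bullet>c ?y)"
      using psd[of ?y] by (simp add: less_eq_complex_def)
    ultimately show ?thesis by simp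
  qed
  have N0: "N \<ge> 0" using conjugate_square_ge_0_vec[of g] by (simp add: N_def less_eq_complex_def)
  have "N = 0"
  proof (rule ccontr)
    assume "N \<noteq> 0"
    then have Np: "N > 0" using N0 by simp
    \<comment> \<open>The quadratic \<open>2 t N + t\<^sup>2 c\<close> is negative for \<open>- 2 N / c < t < 0\<close>; the denominator \<open>c + 1\<close>
      also covers \<open>c = 0\<close>.\<close>
    let ?t = "- N / (c + 1)"
    have "2 * ?t * N + ?t * ?t * c = - (N * N * (c + 2)) / ((c + 1) * (c + 1))"
      using c0 by (simp add: divide_simps) (simp add: algebra_simps)
    also have "\<dots> < 0" using Np c0 by (simp add: divide_neg_pos)
    finally show False using quad[of ?t] by simp
  qed
  then have "g \<bullet>c g = 0" using gg by simp
  then show ?thesis using g unfolding g_def by (simp add: conjugate_square_eq_0_vec[of _ n])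
qed

section \<open>From real to complex vectors\<close>

lemma real_mat_mult_vec_conjugate:
  assumes "A \<in> mat_over \<real> r c" and "v \<in> carrier_vec c"
  shows "conjugate (A *\<^sub>v v) = A *\<^sub>v conjugate v"
proof -
  have A: "A \<in> carrier_mat r c" using assms by (simp add: mat_over_def)
  have re: "cnj (A $$ (i, j)) = A $$ (i, j)" if "i < r" "j < c" for i j
  proof -
    have "A $$ (i, j) \<in> elements_mat A" using A that by auto
    then show ?thesis using assms(1) by (auto simp: mat_over_def Reals_cnj_iff)
  qed
  show ?thesis
  proof (rule eq_vecI)
    show "conjugate (A *\<^sub>v v) $ i = (A *\<^sub>v conjugate v) $ i"
      if "i < dim_vec (A *\<^sub>v conjugate v)" for i
      using that A assms(2) re by (auto simp: scalar_prod_def conjugate_complex_def)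
  qed (use A in simp)
qed

lemma real_imag_parts:
  fixes x :: "complex vec"
  assumes "x \<in> carrier_vec n"
  obtains a b where "a \<in> vec_over \<real> n" and "b \<in> vec_over \<real> n"
    and "conjugate a = a" and "conjugate b = b" and "x = a + \<i> \<cdot>\<^sub>v b"
proof
  let ?a = "map_vec (\<lambda>z. complex_of_real (Re z)) x"
  let ?b = "map_vec (\<lambda>z. complex_of_real (Im z)) x"
  show "?a \<in> vec_over \<real> n" "?b \<in> vec_over \<real> n"
    using assms by (auto simp: vec_over_def vec_set_def)
  show "conjugate ?a = ?a" "conjugate ?b = ?b"
    by (auto simp: conjugate_complex_def)
  show "x = ?a + \<i> \<cdot>\<^sub>v ?b"
    using assms by (auto simp: complex_eq_iff)
qed

text \<open>
  For a real symmetric \<open>A\<close> and \<open>x = a + i b\<close> with real \<open>a\<close> and \<open>b\<close>, the mixed terms of \<open>x\<^sup>H A x\<close>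
  cancel by symmetry and \<open>a\<^sup>T A a + b\<^sup>T A b\<close> is left.
\<close>

lemma psd_complexification:
  assumes K: "K = \<real> \<or> K = UNIV" and A: "A \<in> mat_over K n n"
    and sym: "mat_adjoint A = A" and psd: "psd_over K A" and x: "x \<in> carrier_vec n"
  shows "0 \<le> (A *\<^sub>v x) \<bullet>c x"
proof -
  have Ac [simp]: "A \<in> carrier_mat n n" using A by (simp add: mat_over_def)
  have K_psd: "0 \<le> (A *\<^sub>v y) \<bullet>c y" if "y \<in> vec_over K n" for y
  proof -
    have "y \<in> carrier_vec n" using that by (simp add: vec_over_def)
    then show ?thesis using psd that psd_form_eq[OF Ac] Ac unfolding psd_over_def by fastforce
  qed
  show ?thesis
  proof (cases "K = UNIV")
    case True
    then show ?thesis using K_psd x by (simp add: vec_over_def)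
  next
    case False
    then have KR: "K = \<real>" using K by simp
    obtain a b where ab: "a \<in> vec_over \<real> n" "b \<in> vec_over \<real> n"
      and cj: "conjugate a = a" "conjugate b = b" and xab: "x = a + \<i> \<cdot>\<^sub>v b"
      using real_imag_parts[OF x] by metis
    have [simp]: "a \<in> carrier_vec n" "b \<in> carrier_vec n" using ab by (auto simp: vec_over_def)
    have Aab [simp]: "A *\<^sub>v a \<in> carrier_vec n" "A *\<^sub>v b \<in> carrier_vec n"
      by (auto intro: mult_mat_vec_carrier[OF Ac])
    have Ax: "A *\<^sub>v x = A *\<^sub>v a + \<i> \<cdot>\<^sub>v (A *\<^sub>v b)"
      unfolding xab by (subst mult_add_distrib_mat_vec[of _ n n]) (auto simp: mult_mat_vec[of _ n n])
    have cross: "(A *\<^sub>v a) \<bullet>c b = (A *\<^sub>v b) \<bullet>c a"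
    proof -
      have "(A *\<^sub>v a) \<bullet>c b = a \<bullet>c (A *\<^sub>v b)"
        using cscalar_prod_adjoint[of A n n a b] sym by simp
      also have "\<dots> = a \<bullet> (A *\<^sub>v b)"
        using real_mat_mult_vec_conjugate[of A n n b] A KR cj by simp
      also have "\<dots> = (A *\<^sub>v b) \<bullet>c a"
        unfolding cj by (rule comm_scalar_prod[of _ n]) auto
      finally show ?thesis .
    qed
    have "(A *\<^sub>v x) \<bullet>c x = (A *\<^sub>v a) \<bullet>c x + \<i> * ((A *\<^sub>v b) \<bullet>c x)"
      unfolding Ax by (rule cscalar_prod_add_smult_left[OF Aab x])
    also have "\<dots> = (A *\<^sub>v a) \<bullet>c a + (A *\<^sub>v b) \<bullet>c b"
      unfolding xab
      by (simp add: cscalar_prod_add_right[of _ n] cscalar_prod_smult_right[of _ n] cross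
          algebra_simps)
    finally show ?thesis using K_psd ab KR by simp
  qed
qed

text \<open>
  Real matrices map real vectors to real vectors, so they annihilate a complex vector only if they
  annihilate its real and its imaginary part.
\<close>

lemma common_kernel_trivial_complexification:
  assumes K: "K = \<real> \<or> K = UNIV" and B: "B \<in> mat_over K n m" and S: "S \<in> mat_over K m m"
    and triv: "ker_over K B \<inter> ker_over K S = {0\<^sub>v m}"
    and u: "u \<in> carrier_vec m" and Bu: "B *\<^sub>v u = 0\<^sub>v n" and Su: "S *\<^sub>v u = 0\<^sub>v m"
  shows "u = 0\<^sub>v m"
proof -
  have Bc: "B \<in> carrier_mat n m" and Sc: "S \<in> carrier_mat m m"
    using B S by (auto simp: mat_over_def)
  have mem: "v = 0\<^sub>v m" if "v \<in> vec_over K m" "B *\<^sub>v v = 0\<^sub>v n" "S *\<^sub>v v = 0\<^sub>v m" for v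
  proof -
    have "v \<in> carrier_vec m" using that(1) by (simp add: vec_over_def)
    then have "v \<in> ker_over K B \<inter> ker_over K S"
      using that Bc Sc by (auto simp: ker_over_def mat_kernel_def)
    then show ?thesis using triv by simp
  qed
  show ?thesis
  proof (cases "K = UNIV")
    case True
    then show ?thesis using mem u Bu Su by (simp add: vec_over_def)
  next
    case False
    then have KR: "K = \<real>" using K by simp
    obtain a b where ab: "a \<in> vec_over \<real> m" "b \<in> vec_over \<real> m"
      and cj: "conjugate a = a" "conjugate b = b" and uab: "u = a + \<i> \<cdot>\<^sub>v b"
      using real_imag_parts[OF u] by metis
    have abc: "a \<in> carrier_vec m" "b \<in> carrier_vec m" using ab by (auto simp: vec_over_def)
    have split: "A *\<^sub>v a = 0\<^sub>v r \<and> A *\<^sub>v b = 0\<^sub>v r"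
      if A: "A \<in> mat_over \<real> r m" and Au: "A *\<^sub>v u = 0\<^sub>v r" for A r
    proof -
      have Ac: "A \<in> carrier_mat r m" using A by (simp add: mat_over_def)
      have re: "conjugate (A *\<^sub>v a) = A *\<^sub>v a" "conjugate (A *\<^sub>v b) = A *\<^sub>v b"
        using real_mat_mult_vec_conjugate[OF A] abc cj by auto
      have sum: "A *\<^sub>v a + \<i> \<cdot>\<^sub>v (A *\<^sub>v b) = 0\<^sub>v r"
        using Au abc Ac unfolding uab
        by (simp add: mult_add_distrib_mat_vec[of _ r m] mult_mat_vec[of _ r m])
      have "(A *\<^sub>v a) $ i = 0 \<and> (A *\<^sub>v b) $ i = 0" if i: "i < r" for i
      proof -
        have "cnj ((A *\<^sub>v a) $ i) = (A *\<^sub>v a) $ i" "cnj ((A *\<^sub>v b) $ i) = (A *\<^sub>v b) $ i"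
          using arg_cong[OF re(1), of "\<lambda>v. v $ i"] arg_cong[OF re(2), of "\<lambda>v. v $ i"] i Ac
          by (auto simp: conjugate_complex_def simp del: index_mult_mat_vec)
        moreover have "(A *\<^sub>v a) $ i + \<i> * (A *\<^sub>v b) $ i = 0"
          using arg_cong[OF sum, of "\<lambda>v. v $ i"] i Ac by (simp del: index_mult_mat_vec)
        ultimately show ?thesis by (simp add: complex_eq_iff del: index_mult_mat_vec)
      qed
      then show ?thesis using Ac by (auto simp del: index_mult_mat_vec intro!: eq_vecI)
    qed
    have "a = 0\<^sub>v m" "b = 0\<^sub>v m"
      using mem split[OF B[unfolded KR] Bu] split[OF S[unfolded KR] Su] ab KR by auto
    then show ?thesis unfolding uab by (auto intro!: eq_vecI)
  qed
qed

section \<open>The pencil as an operator on block vectors\<close>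

lemma append_cols_carrier [simp]:
  "A \<in> carrier_mat nr nc1 \<Longrightarrow> B \<in> carrier_mat nr nc2 \<Longrightarrow> A @\<^sub>c B \<in> carrier_mat nr (nc1 + nc2)"
  unfolding append_cols_def by (intro carrier_matI) auto

lemma append_cols_mult_vec:
  fixes A B :: "'a :: comm_semiring_0 mat"
  assumes A: "A \<in> carrier_mat nr nc1" and B: "B \<in> carrier_mat nr nc2"
    and v: "v \<in> carrier_vec nc1" and w: "w \<in> carrier_vec nc2"
  shows "(A @\<^sub>c B) *\<^sub>v (v @\<^sub>v w) = A *\<^sub>v v + B *\<^sub>v w"
proof -
  have "(A @\<^sub>c B) *\<^sub>v (v @\<^sub>v w) =
      (A *\<^sub>v v + B *\<^sub>v w) @\<^sub>v (0\<^sub>m 0 nc1 *\<^sub>v v + 0\<^sub>m 0 nc2 *\<^sub>v w)"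
    using four_block_mat_mult_vec[OF A B _ _ v w, of "0\<^sub>m 0 nc1" 0 "0\<^sub>m 0 nc2"] A B
    by (simp add: append_cols_def)
  also have "\<dots> = A *\<^sub>v v + B *\<^sub>v w" using A B v w by (intro eq_vecI) auto
  finally show ?thesis .
qed

lemma block_row_mult_vec:
  fixes A B C :: "'a :: comm_semiring_0 mat"
  assumes "A \<in> carrier_mat r n" and "B \<in> carrier_mat r k" and "C \<in> carrier_mat r m"
    and "x \<in> carrier_vec n" and "y \<in> carrier_vec k" and "u \<in> carrier_vec m"
  shows "A @\<^sub>c B @\<^sub>c C \<in> carrier_mat r (n + (k + m))"
    and "(A @\<^sub>c B @\<^sub>c C) *\<^sub>v (x @\<^sub>v y @\<^sub>v u) = A *\<^sub>v x + (B *\<^sub>v y + C *\<^sub>v u)"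
proof -
  have BC: "B @\<^sub>c C \<in> carrier_mat r (k + m)" using assms by simp
  have yu: "y @\<^sub>v u \<in> carrier_vec (k + m)" using assms by auto
  show "A @\<^sub>c B @\<^sub>c C \<in> carrier_mat r (n + (k + m))" using assms(1) BC by simp
  show "(A @\<^sub>c B @\<^sub>c C) *\<^sub>v (x @\<^sub>v y @\<^sub>v u) = A *\<^sub>v x + (B *\<^sub>v y + C *\<^sub>v u)"
    unfolding append_cols_mult_vec[OF assms(1) BC assms(4) yu]
      append_cols_mult_vec[OF assms(2,3,5,6)] ..
qed

lemma append_rows_mult_vec:
  fixes A B C :: "'a :: comm_semiring_1 mat"
  assumes A: "A \<in> carrier_mat r nc" and B: "B \<in> carrier_mat k nc" and C: "C \<in> carrier_mat m nc"
    and v: "v \<in> carrier_vec nc"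
  shows "(A @\<^sub>r B @\<^sub>r C) *\<^sub>v v = (A *\<^sub>v v) @\<^sub>v (B *\<^sub>v v) @\<^sub>v (C *\<^sub>v v)"
  unfolding mat_mult_append[OF A carrier_append_rows[OF B C] v] mat_mult_append[OF B C v] ..

lemma zero_mat_mult_vec:
  "x \<in> carrier_vec c \<Longrightarrow> 0\<^sub>m r c *\<^sub>v x = (0\<^sub>v r :: 'a :: semiring_0 vec)"
  by (intro eq_vecI) auto

lemma mat_mult_zero_vec:
  fixes A :: "'a :: semiring_0 mat"
  shows "A \<in> carrier_mat r c \<Longrightarrow> A *\<^sub>v 0\<^sub>v c = 0\<^sub>v r"
  by (intro eq_vecI) auto

lemma mat_mult_uminus_vec:
  fixes A :: "'a :: ring mat"
  shows "A \<in> carrier_mat r c \<Longrightarrow> v \<in> carrier_vec c \<Longrightarrow> A *\<^sub>v (- v) = - (A *\<^sub>v v)"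
  by (intro eq_vecI) auto

lemma smult_mat_mult_vec:
  fixes A :: "'a :: comm_semiring_0 mat"
  assumes "A \<in> carrier_mat r c" and "v \<in> carrier_vec c"
  shows "(k \<cdot>\<^sub>m A) *\<^sub>v v = k \<cdot>\<^sub>v (A *\<^sub>v v)"
  using assms by (intro eq_vecI) (auto simp: scalar_prod_def sum_distrib_left ac_simps)

lemma pencil_E_carrier [simp]: "pencil_E n m \<in> carrier_mat (n + (n + m)) (n + (n + m))"
  unfolding pencil_E_def append_rows_def append_cols_def by (intro carrier_matI) simp_all

lemma pencil_E_mult_vec:
  assumes x: "x \<in> carrier_vec n" and y: "y \<in> carrier_vec n" and u: "u \<in> carrier_vec m"
  shows "pencil_E n m *\<^sub>v (x @\<^sub>v y @\<^sub>v u) = y @\<^sub>v (- x) @\<^sub>v 0\<^sub>v m"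
proof -
  note r1 = block_row_mult_vec[OF zero_carrier_mat[of n n] one_carrier_mat[of n]
      zero_carrier_mat[of n m] x y u]
  note r2 = block_row_mult_vec[OF uminus_carrier_mat[OF one_carrier_mat[of n]]
      zero_carrier_mat[of n n] zero_carrier_mat[of n m] x y u]
  note r3 = block_row_mult_vec[OF zero_carrier_mat[of m n] zero_carrier_mat[of m n]
      zero_carrier_mat[of m m] x y u]
  have v: "x @\<^sub>v y @\<^sub>v u \<in> carrier_vec (n + (n + m))" using x y u by auto
  show ?thesis
    unfolding pencil_E_def append_rows_mult_vec[OF r1(1) r2(1) r3(1) v] r1(2) r2(2) r3(2)
    using x y u by (simp add: zero_mat_mult_vec)
qed

lemma pencil_A_carrier:
  assumes "J \<in> carrier_mat n n" and "R \<in> carrier_mat n n" and "Q \<in> carrier_mat n n"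
    and "B \<in> carrier_mat n m" and "S \<in> carrier_mat m m"
  shows "pencil_A n m J R Q B S \<in> carrier_mat (n + (n + m)) (n + (n + m))"
  using assms unfolding pencil_A_def append_rows_def append_cols_def
  by (intro carrier_matI) simp_all

lemma pencil_A_mult_vec:
  assumes J: "J \<in> carrier_mat n n" and R: "R \<in> carrier_mat n n" and Q: "Q \<in> carrier_mat n n"
    and B: "B \<in> carrier_mat n m" and S: "S \<in> carrier_mat m m"
    and x: "x \<in> carrier_vec n" and y: "y \<in> carrier_vec n" and u: "u \<in> carrier_vec m"
  shows "pencil_A n m J R Q B S *\<^sub>v (x @\<^sub>v y @\<^sub>v u) =
    (((J - R) * Q) *\<^sub>v y + B *\<^sub>v u) @\<^sub>v
    (mat_adjoint ((J - R) * Q) *\<^sub>v x + (Q * R * Q) *\<^sub>v y) @\<^sub>v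
    (mat_adjoint B *\<^sub>v x + S *\<^sub>v u)"
proof -
  have W: "(J - R) * Q \<in> carrier_mat n n" and QRQ: "Q * R * Q \<in> carrier_mat n n"
    using J R Q by auto
  note WH = mat_adjoint_carrier[OF W] and BH = mat_adjoint_carrier[OF B]
  note r1 = block_row_mult_vec[OF zero_carrier_mat[of n n] W B x y u]
  note r2 = block_row_mult_vec[OF WH QRQ zero_carrier_mat[of n m] x y u]
  note r3 = block_row_mult_vec[OF BH zero_carrier_mat[of m n] S x y u]
  have v: "x @\<^sub>v y @\<^sub>v u \<in> carrier_vec (n + (n + m))" using x y u by auto
  have c: "((J - R) * Q) *\<^sub>v y \<in> carrier_vec n" "B *\<^sub>v u \<in> carrier_vec n"
    "mat_adjoint ((J - R) * Q) *\<^sub>v x \<in> carrier_vec n" "(Q * R * Q) *\<^sub>v y \<in> carrier_vec n"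
    "mat_adjoint B *\<^sub>v x \<in> carrier_vec m" "S *\<^sub>v u \<in> carrier_vec m"
    using mult_mat_vec_carrier W B WH QRQ BH S x y u by blast+
  have z: "0\<^sub>m n n *\<^sub>v x = 0\<^sub>v n" "0\<^sub>m n m *\<^sub>v u = 0\<^sub>v n" "0\<^sub>m m n *\<^sub>v y = 0\<^sub>v m"
    using x y u by auto
  show ?thesis
    unfolding pencil_A_def append_rows_mult_vec[OF r1(1) r2(1) r3(1) v] r1(2) r2(2) r3(2) z
    using c by simp
qed

lemma pencil_kernel_iff:
  assumes J: "J \<in> carrier_mat n n" and R: "R \<in> carrier_mat n n" and Q: "Q \<in> carrier_mat n n"
    and B: "B \<in> carrier_mat n m" and S: "S \<in> carrier_mat m m"
    and x: "x \<in> carrier_vec n" and y: "y \<in> carrier_vec n" and u: "u \<in> carrier_vec m"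
  shows "(s \<cdot>\<^sub>m pencil_E n m - pencil_A n m J R Q B S) *\<^sub>v (x @\<^sub>v y @\<^sub>v u) = 0\<^sub>v (n + (n + m)) \<longleftrightarrow>
    s \<cdot>\<^sub>v y = ((J - R) * Q) *\<^sub>v y + B *\<^sub>v u \<and>
    s \<cdot>\<^sub>v (- x) = mat_adjoint ((J - R) * Q) *\<^sub>v x + (Q * R * Q) *\<^sub>v y \<and>
    0\<^sub>v m = mat_adjoint B *\<^sub>v x + S *\<^sub>v u"
proof -
  let ?v = "x @\<^sub>v y @\<^sub>v u"
  let ?N = "n + (n + m)"
  note A = pencil_A_carrier[OF J R Q B S]
  have v: "?v \<in> carrier_vec ?N" using x y u by auto
  have diff: "a - b = 0\<^sub>v k \<longleftrightarrow> a = b" if "a \<in> carrier_vec k" "b \<in> carrier_vec k"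
    for a b :: "complex vec" and k
    using that by (auto simp: vec_eq_iff)
  have smult: "s \<cdot>\<^sub>v (y @\<^sub>v (- x) @\<^sub>v 0\<^sub>v m) = (s \<cdot>\<^sub>v y) @\<^sub>v (s \<cdot>\<^sub>v (- x)) @\<^sub>v 0\<^sub>v m"
    by (intro eq_vecI) auto
  have sy: "s \<cdot>\<^sub>v y \<in> carrier_vec n" and sx: "s \<cdot>\<^sub>v (- x) \<in> carrier_vec n"
    using x y by auto
  have W: "(J - R) * Q \<in> carrier_mat n n" and QRQ: "Q * R * Q \<in> carrier_mat n n"
    using J R Q by auto
  have c: "((J - R) * Q) *\<^sub>v y + B *\<^sub>v u \<in> carrier_vec n"
    "mat_adjoint ((J - R) * Q) *\<^sub>v x + (Q * R * Q) *\<^sub>v y \<in> carrier_vec n"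
    by (intro add_carrier_vec mult_mat_vec_carrier[OF W y] mult_mat_vec_carrier[OF B u]
        mult_mat_vec_carrier[OF mat_adjoint_carrier[OF W] x] mult_mat_vec_carrier[OF QRQ y])+
  have "(s \<cdot>\<^sub>m pencil_E n m - pencil_A n m J R Q B S) *\<^sub>v ?v =
      s \<cdot>\<^sub>v (pencil_E n m *\<^sub>v ?v) - pencil_A n m J R Q B S *\<^sub>v ?v"
    using v A pencil_E_carrier[of n m]
    by (subst minus_mult_distrib_mat_vec[of _ ?N ?N]) (auto simp: smult_mat_mult_vec[of _ ?N ?N])
  moreover have "\<dots> = 0\<^sub>v ?N \<longleftrightarrow> s \<cdot>\<^sub>v (pencil_E n m *\<^sub>v ?v) = pencil_A n m J R Q B S *\<^sub>v ?v"
    by (intro diff iffD2[OF smult_carrier_vec] mult_mat_vec_carrier[OF pencil_E_carrier v]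
        mult_mat_vec_carrier[OF A v])
  moreover have "\<dots> \<longleftrightarrow> s \<cdot>\<^sub>v y = ((J - R) * Q) *\<^sub>v y + B *\<^sub>v u \<and>
    s \<cdot>\<^sub>v (- x) = mat_adjoint ((J - R) * Q) *\<^sub>v x + (Q * R * Q) *\<^sub>v y \<and>
    0\<^sub>v m = mat_adjoint B *\<^sub>v x + S *\<^sub>v u"
    unfolding pencil_E_mult_vec[OF x y u] pencil_A_mult_vec[OF J R Q B S x y u] smult
      append_vec_eq[OF sy c(1)] append_vec_eq[OF sx c(2)] ..
  ultimately show ?thesis by simp
qed

lemma poly_det_pencil:
  assumes E: "E \<in> carrier_mat N N" and A: "A \<in> carrier_mat N N"
  shows "poly (det (pencil E A)) s = det (s \<cdot>\<^sub>m E - A)"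
  by (rule poly_det_cong[of _ N]) (use E A in \<open>auto simp: pencil_def\<close>)

lemma ex_imaginary_axis_avoiding_finite:
  assumes "finite (X :: complex set)"
  shows "\<exists>\<omega>::real. \<i> * complex_of_real \<omega> \<notin> X"
proof (rule ccontr)
  assume "\<not> ?thesis"
  then have "range (\<lambda>\<omega>::real. \<i> * complex_of_real \<omega>) \<subseteq> X" by auto
  then have "finite (range (\<lambda>\<omega>::real. \<i> * complex_of_real \<omega>))"
    using assms by (rule finite_subset)
  then have "finite (UNIV :: real set)" by (rule finite_imageD) (simp add: inj_def)
  then show False using infinite_UNIV_char_0 by blast
qed

section \<open>Kernel vectors on the imaginary axis\<close>

text \<open>
  Since \<open>P = W - s\<close> is injective, it is onto, and a vector \<open>x = P z\<close> with \<open>P\<^sup>H x = 0\<close> satisfies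
  \<open>x\<^sup>H x = x\<^sup>H P z = 0\<close>. The adjugate of \<open>P\<close> produces \<open>z\<close> up to the factor \<open>det P\<close>.
\<close>

lemma adjoint_eigenvector_trivial:
  fixes W :: "complex mat"
  assumes W: "W \<in> carrier_mat n n"
    and inj: "\<And>z. z \<in> carrier_vec n \<Longrightarrow> W *\<^sub>v z = s \<cdot>\<^sub>v z \<Longrightarrow> z = 0\<^sub>v n"
    and x: "x \<in> carrier_vec n" and ker: "mat_adjoint W *\<^sub>v x = cnj s \<cdot>\<^sub>v x"
  shows "x = 0\<^sub>v n"
proof -
  define P where "P = W - s \<cdot>\<^sub>m 1\<^sub>m n"
  have P: "P \<in> carrier_mat n n" unfolding P_def by (intro minus_carrier_mat) simp
  have Pz: "P *\<^sub>v z = W *\<^sub>v z - s \<cdot>\<^sub>v z" if "z \<in> carrier_vec n" for z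
    unfolding P_def using that W
    by (subst minus_mult_distrib_mat_vec[of _ n n]) (auto simp: smult_mat_mult_vec[of _ n n])
  have "det P \<noteq> 0"
  proof
    assume "det P = 0"
    then obtain z where z: "z \<in> carrier_vec n" "z \<noteq> 0\<^sub>v n" "P *\<^sub>v z = 0\<^sub>v n"
      using det_0_iff_vec_prod_zero[OF P] by auto
    then have "W *\<^sub>v z - s \<cdot>\<^sub>v z = 0\<^sub>v n" using Pz by simp
    then have "W *\<^sub>v z = s \<cdot>\<^sub>v z" using z(1) W by (auto simp: vec_eq_iff)
    then show False using inj z by blast
  qed
  define z where "z = adj_mat P *\<^sub>v x"
  have z: "z \<in> carrier_vec n" unfolding z_def by (rule mult_mat_vec_carrier[OF adj_mat(1)[OF P] x])
  have "P *\<^sub>v z = (P * adj_mat P) *\<^sub>v x"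
    unfolding z_def by (rule assoc_mult_mat_vec[symmetric, OF P adj_mat(1)[OF P] x])
  also have "\<dots> = det P \<cdot>\<^sub>v x"
    unfolding adj_mat(2)[OF P] using x by (simp add: smult_mat_mult_vec[of _ n n])
  finally have "det P * (x \<bullet>c x) = (P *\<^sub>v z) \<bullet>c x" using x by simp
  also have "\<dots> = (W *\<^sub>v z) \<bullet>c x - s * (z \<bullet>c x)"
    unfolding Pz[OF z] using W z x by (subst minus_scalar_prod_distrib[of _ n]) auto
  also have "(W *\<^sub>v z) \<bullet>c x = z \<bullet>c (cnj s \<cdot>\<^sub>v x)"
    unfolding cscalar_prod_adjoint[OF W z x] ker ..
  also have "\<dots> - s * (z \<bullet>c x) = 0" by (simp add: cscalar_prod_smult_right[OF z x])
  finally have "x \<bullet>c x = 0" using \<open>det P \<noteq> 0\<close> by simp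
  then show ?thesis using x by (simp add: conjugate_square_eq_0_vec[of _ n])
qed

text \<open>
  Pair \<open>J w - R w = i \<omega> z\<close> with \<open>w = Q z\<close>. The terms \<open>w\<^sup>H J w\<close> and \<open>i \<omega> w\<^sup>H z\<close> are
  purely imaginary because \<open>J\<close> is skew-Hermitian and \<open>Q\<close> is Hermitian. Hence \<open>w\<^sup>H R w = 0\<close>, so
  \<open>R Q z = 0\<close> and \<open>R\<close> drops out of the eigenvalue equation.
\<close>

lemma dissipative_imaginary_eigenvector:
  fixes J R Q :: "complex mat"
  assumes J: "J \<in> carrier_mat n n" and R: "R \<in> carrier_mat n n" and Q: "Q \<in> carrier_mat n n"
    and skew: "J = - mat_adjoint J" and Rsym: "mat_adjoint R = R" and Qsym: "mat_adjoint Q = Q"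
    and Rpsd: "\<And>x. x \<in> carrier_vec n \<Longrightarrow> 0 \<le> (R *\<^sub>v x) \<bullet>c x"
    and z: "z \<in> carrier_vec n"
    and eig: "((J - R) * Q) *\<^sub>v z = (\<i> * complex_of_real \<omega>) \<cdot>\<^sub>v z"
  shows "(J * Q) *\<^sub>v z = (\<i> * complex_of_real \<omega>) \<cdot>\<^sub>v z"
proof -
  define w where "w = Q *\<^sub>v z"
  have w: "w \<in> carrier_vec n" unfolding w_def by (rule mult_mat_vec_carrier[OF Q z])
  have Jw: "J *\<^sub>v w \<in> carrier_vec n" and Rw: "R *\<^sub>v w \<in> carrier_vec n"
    by (rule mult_mat_vec_carrier[OF J w], rule mult_mat_vec_carrier[OF R w])
  have JR: "J - R \<in> carrier_mat n n" using R by (rule minus_carrier_mat)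
  have eq: "J *\<^sub>v w - R *\<^sub>v w = (\<i> * complex_of_real \<omega>) \<cdot>\<^sub>v z"
    using eig unfolding assoc_mult_mat_vec[OF JR Q z] w_def[symmetric]
      minus_mult_distrib_mat_vec[OF J R w] .
  have "cnj (z \<bullet>c w) = z \<bullet>c w"
    unfolding conjugate_cscalar_prod[OF z w] using cscalar_prod_adjoint[OF Q z z] Qsym
    by (simp add: w_def)
  then have "Re ((\<i> * complex_of_real \<omega>) * (z \<bullet>c w)) = 0" by (simp add: complex_eq_iff)
  moreover have "(J *\<^sub>v w) \<bullet>c w - (R *\<^sub>v w) \<bullet>c w = (\<i> * complex_of_real \<omega>) * (z \<bullet>c w)"
    using arg_cong[OF eq, of "\<lambda>v. v \<bullet>c w"] Jw Rw z w
    by (simp add: minus_scalar_prod_distrib[of _ n])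
  moreover have "Re ((J *\<^sub>v w) \<bullet>c w) = 0"
  proof -
    have JH: "mat_adjoint J *\<^sub>v w = - (J *\<^sub>v w)"
    proof -
      have "mat_adjoint J = - J" by (subst (2) skew) simp
      then show ?thesis using J w by simp
    qed
    have "(J *\<^sub>v w) \<bullet>c w = w \<bullet>c (- (J *\<^sub>v w))"
      unfolding cscalar_prod_adjoint[OF J w w] JH ..
    also have "\<dots> = - (w \<bullet>c (J *\<^sub>v w))"
      by (rule cscalar_prod_uminus_right[OF w Jw])
    also have "\<dots> = - cnj ((J *\<^sub>v w) \<bullet>c w)" unfolding conjugate_cscalar_prod[OF Jw w] ..
    finally show ?thesis by (simp add: complex_eq_iff)
  qed
  ultimately have "Re ((R *\<^sub>v w) \<bullet>c w) = 0" by (metis diff_0 minus_complex.simps(1) neg_equal_0_iff_equal)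
  then have R0: "R *\<^sub>v w = 0\<^sub>v n" using psd_form_zero[OF R Rsym Rpsd w] by blast
  have "(J * Q) *\<^sub>v z = J *\<^sub>v w" unfolding w_def by (rule assoc_mult_mat_vec[OF J Q z])
  also have "\<dots> = J *\<^sub>v w - R *\<^sub>v w" using R0 Jw by simp
  finally show ?thesis using eq by simp
qed

text \<open>
  The energy argument. The hypotheses \<open>spec\<close>, \<open>inter\<close> and \<open>BS\<close> state the three conditions on
  \<open>\<omega>\<close> elementwise, with the signs in which the kernel equations deliver them: replacing \<open>u\<close> by
  \<open>- u\<close> turns \<open>inter\<close> into the condition that \<open>B ker S\<close> and \<open>(J Q - i \<omega>) ker R Q\<close> meet only in
  zero.
\<close>

lemma pencil_kernel_trivial:
  fixes J R Q B S :: "complex mat"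
  assumes J: "J \<in> carrier_mat n n" and R: "R \<in> carrier_mat n n" and Q: "Q \<in> carrier_mat n n"
    and B: "B \<in> carrier_mat n m" and S: "S \<in> carrier_mat m m"
    and skew: "J = - mat_adjoint J" and Rsym: "mat_adjoint R = R" and Qsym: "mat_adjoint Q = Q"
    and Ssym: "mat_adjoint S = S"
    and Rpsd: "\<And>x. x \<in> carrier_vec n \<Longrightarrow> 0 \<le> (R *\<^sub>v x) \<bullet>c x"
    and Spsd: "\<And>x. x \<in> carrier_vec m \<Longrightarrow> 0 \<le> (S *\<^sub>v x) \<bullet>c x"
    and spec: "\<And>z. z \<in> carrier_vec n \<Longrightarrow> (J * Q) *\<^sub>v z = (\<i> * complex_of_real \<omega>) \<cdot>\<^sub>v z \<Longrightarrow> z = 0\<^sub>v n"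
    and inter: "\<And>u y. u \<in> carrier_vec m \<Longrightarrow> y \<in> carrier_vec n \<Longrightarrow> S *\<^sub>v u = 0\<^sub>v m \<Longrightarrow>
        (R * Q) *\<^sub>v y = 0\<^sub>v n \<Longrightarrow>
        (J * Q) *\<^sub>v y + B *\<^sub>v u = (\<i> * complex_of_real \<omega>) \<cdot>\<^sub>v y \<Longrightarrow> B *\<^sub>v u = 0\<^sub>v n"
    and BS: "\<And>u. u \<in> carrier_vec m \<Longrightarrow> B *\<^sub>v u = 0\<^sub>v n \<Longrightarrow> S *\<^sub>v u = 0\<^sub>v m \<Longrightarrow> u = 0\<^sub>v m"
    and x: "x \<in> carrier_vec n" and y: "y \<in> carrier_vec n" and u: "u \<in> carrier_vec m"
    and ker1: "(\<i> * complex_of_real \<omega>) \<cdot>\<^sub>v y = ((J - R) * Q) *\<^sub>v y + B *\<^sub>v u"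
    and ker2: "(\<i> * complex_of_real \<omega>) \<cdot>\<^sub>v (- x) =
        mat_adjoint ((J - R) * Q) *\<^sub>v x + (Q * R * Q) *\<^sub>v y"
    and ker3: "0\<^sub>v m = mat_adjoint B *\<^sub>v x + S *\<^sub>v u"
  shows "x = 0\<^sub>v n \<and> y = 0\<^sub>v n \<and> u = 0\<^sub>v m"
proof -
  let ?s = "\<i> * complex_of_real \<omega>"
  define W where "W = (J - R) * Q"
  define w where "w = Q *\<^sub>v y"
  have JR: "J - R \<in> carrier_mat n n" using R by (rule minus_carrier_mat)
  have W: "W \<in> carrier_mat n n" unfolding W_def by (rule mult_carrier_mat[OF JR Q])
  have w: "w \<in> carrier_vec n" unfolding w_def by (rule mult_mat_vec_carrier[OF Q y])
  note Rw = mult_mat_vec_carrier[OF R w]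
  note QRw = mult_mat_vec_carrier[OF Q Rw]
  note Wy = mult_mat_vec_carrier[OF W y]
  note Bu = mult_mat_vec_carrier[OF B u]
  note Su = mult_mat_vec_carrier[OF S u]
  note WHx = mult_mat_vec_carrier[OF mat_adjoint_carrier[OF W] x]
  note BHx = mult_mat_vec_carrier[OF mat_adjoint_carrier[OF B] x]
  have QRQy: "(Q * R * Q) *\<^sub>v y = Q *\<^sub>v (R *\<^sub>v w)"
    unfolding w_def assoc_mult_mat_vec[OF mult_carrier_mat[OF Q R] Q y]
    by (rule assoc_mult_mat_vec[OF Q R mult_mat_vec_carrier[OF Q y]])
  note k1 = ker1[folded W_def] and k2 = ker2[folded W_def, unfolded QRQy]
  \<comment> \<open>The first two pairings have the same left-hand side because \<open>- s\<close> is the conjugate of \<open>s\<close>.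
    Subtracting them eliminates \<open>W\<close>, and the third pairing then eliminates \<open>B\<close>.\<close>
  have pair1: "?s * (y \<bullet>c x) = y \<bullet>c (mat_adjoint W *\<^sub>v x) + u \<bullet>c (mat_adjoint B *\<^sub>v x)"
    using arg_cong[OF k1, of "\<lambda>v. v \<bullet>c x"] Wy Bu x y
    by (simp add: add_scalar_prod_distrib[of _ n] cscalar_prod_adjoint[OF W y x]
        cscalar_prod_adjoint[OF B u x])
  have pair2: "?s * (y \<bullet>c x) = y \<bullet>c (mat_adjoint W *\<^sub>v x) + y \<bullet>c (Q *\<^sub>v (R *\<^sub>v w))"
  proof -
    have "y \<bullet>c (?s \<cdot>\<^sub>v (- x)) = ?s * (y \<bullet>c x)"
      using x y by (simp add: cscalar_prod_smult_right[of _ n] cscalar_prod_uminus_right[of _ n])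
    then show ?thesis
      using arg_cong[OF k2, of "\<lambda>v. y \<bullet>c v"] by (simp add: cscalar_prod_add_right[OF y WHx QRw])
  qed
  have pair3: "u \<bullet>c (mat_adjoint B *\<^sub>v x) + u \<bullet>c (S *\<^sub>v u) = 0"
    using arg_cong[OF ker3, of "\<lambda>v. u \<bullet>c v"] cscalar_prod_add_right[OF u BHx Su] u by simp
  have "y \<bullet>c (Q *\<^sub>v (R *\<^sub>v w)) = w \<bullet>c (R *\<^sub>v w)"
    using cscalar_prod_adjoint[OF Q y Rw] Qsym by (simp add: w_def)
  also have "\<dots> = (R *\<^sub>v w) \<bullet>c w" using cscalar_prod_adjoint[OF R w w] Rsym by simp
  finally have energy: "(R *\<^sub>v w) \<bullet>c w + (S *\<^sub>v u) \<bullet>c u = 0"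
    using pair1 pair2 pair3 cscalar_prod_adjoint[OF S u u] Ssym by (simp add: algebra_simps)
  have "Re ((R *\<^sub>v w) \<bullet>c w) \<ge> 0" "Re ((S *\<^sub>v u) \<bullet>c u) \<ge> 0"
    using Rpsd[OF w] Spsd[OF u] by (auto simp: less_eq_complex_def)
  moreover have "Re ((R *\<^sub>v w) \<bullet>c w) + Re ((S *\<^sub>v u) \<bullet>c u) = 0"
    using arg_cong[OF energy, of Re] by simp
  ultimately have "Re ((R *\<^sub>v w) \<bullet>c w) = 0" "Re ((S *\<^sub>v u) \<bullet>c u) = 0" by linarith+
  then have Rw0: "R *\<^sub>v w = 0\<^sub>v n" and Su0: "S *\<^sub>v u = 0\<^sub>v m"
    using psd_form_zero[OF R Rsym Rpsd w] psd_form_zero[OF S Ssym Spsd u] by auto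
  have RQy: "(R * Q) *\<^sub>v y = 0\<^sub>v n"
    unfolding assoc_mult_mat_vec[OF R Q y] using Rw0 by (simp add: w_def)
  have WJ: "W *\<^sub>v y = (J * Q) *\<^sub>v y"
    unfolding W_def assoc_mult_mat_vec[OF JR Q y] assoc_mult_mat_vec[OF J Q y] w_def[symmetric]
      minus_mult_distrib_mat_vec[OF J R w] Rw0 using mult_mat_vec_carrier[OF J w] by simp
  have Bu0: "B *\<^sub>v u = 0\<^sub>v n"
    using inter[OF u y Su0 RQy] k1 WJ by simp
  then have u0: "u = 0\<^sub>v m" using BS u Su0 by blast
  have "(J * Q) *\<^sub>v y = ?s \<cdot>\<^sub>v y" using k1 Bu0 Wy by (simp add: WJ)
  then have y0: "y = 0\<^sub>v n" using spec y by blast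
  have "mat_adjoint W *\<^sub>v x = cnj ?s \<cdot>\<^sub>v x"
  proof -
    have "?s \<cdot>\<^sub>v (- x) = mat_adjoint W *\<^sub>v x"
      using k2 Rw0 WHx by (simp add: mat_mult_zero_vec[OF Q])
    moreover have "?s \<cdot>\<^sub>v (- x) = cnj ?s \<cdot>\<^sub>v x" by (intro eq_vecI) auto
    ultimately show ?thesis by simp
  qed
  moreover have "z = 0\<^sub>v n" if "z \<in> carrier_vec n" "W *\<^sub>v z = ?s \<cdot>\<^sub>v z" for z
    using spec that
      dissipative_imaginary_eigenvector[OF J R Q skew Rsym Qsym Rpsd that(1)] by (simp add: W_def)
  ultimately have "x = 0\<^sub>v n" using adjoint_eigenvector_trivial[OF W _ x] by blast
  then show ?thesis using y0 u0 by simp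
qed

theorem proposition3p5:
  fixes K :: "complex set" and n m :: nat and J R Q B S :: "complex mat"
  assumes "K = \<real> \<or> K = UNIV"
    and "n > 0" and "m > 0"
    and "(J, R, Q, B) \<in> Sigma_set K n m"
    and "S \<in> mat_over K m m" and "mat_adjoint S = S" and "psd_over K S"
  shows "regular_pencil (pencil_E n m) (pencil_A n m J R Q B S) \<longleftrightarrow>
    (\<exists>\<omega>::real.
       \<i> * complex_of_real \<omega> \<notin> spectrum (J * Q) \<and>
       (\<lambda>v. B *\<^sub>v v) ` mat_kernel S \<inter>
         (\<lambda>v. (J * Q - (\<i> * complex_of_real \<omega>) \<cdot>\<^sub>m 1\<^sub>m n) *\<^sub>v v) ` mat_kernel (R * Q) = {0\<^sub>v n} \<and>
       ker_over K B \<inter> ker_over K S = {0\<^sub>v m})"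
proof -
  let ?A = "pencil_A n m J R Q B S" and ?E = "pencil_E n m" and ?N = "n + (n + m)"
  let ?s = "\<lambda>\<omega>::real. \<i> * complex_of_real \<omega>"
  have over: "J \<in> mat_over K n n" "R \<in> mat_over K n n" "Q \<in> mat_over K n n" "B \<in> mat_over K n m"
    and skew: "J = - mat_adjoint J" and Rsym: "mat_adjoint R = R" and psdR: "psd_over K R"
    and Qsym: "mat_adjoint Q = Q"
    using assms(4) by (auto simp: Sigma_set_def)
  note J = over(1)[THEN mat_over_carrier] and R = over(2)[THEN mat_over_carrier]
    and Q = over(3)[THEN mat_over_carrier] and B = over(4)[THEN mat_over_carrier]
    and S = assms(5)[THEN mat_over_carrier]
  note JQ = mult_carrier_mat[OF J Q] and RQ = mult_carrier_mat[OF R Q]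
  note Rpsd = psd_complexification[OF assms(1) over(2) Rsym psdR]
    and Spsd = psd_complexification[OF assms(1,5,6,7)]
  note E = pencil_E_carrier[of n m] and A = pencil_A_carrier[OF J R Q B S]
  let ?P = "\<lambda>s. s \<cdot>\<^sub>m ?E - ?A"
  have P: "?P s \<in> carrier_mat ?N ?N" for s using A by (rule minus_carrier_mat)
  note det = poly_det_pencil[OF E A]
  have shift: "(J * Q - s \<cdot>\<^sub>m 1\<^sub>m n) *\<^sub>v y = (J * Q) *\<^sub>v y - s \<cdot>\<^sub>v y" if "y \<in> carrier_vec n" for y s
    using that JQ
    by (subst minus_mult_distrib_mat_vec[of _ n n]) (auto simp: smult_mat_mult_vec[of _ n n])
  have kerS: "mat_kernel S = {u \<in> carrier_vec m. S *\<^sub>v u = 0\<^sub>v m}"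
    and kerRQ: "mat_kernel (R * Q) = {y \<in> carrier_vec n. (R * Q) *\<^sub>v y = 0\<^sub>v n}"
    using S R Q by (auto simp: mat_kernel_def)
  have W: "(J - R) * Q \<in> carrier_mat n n"
    by (rule mult_carrier_mat[OF minus_carrier_mat[OF R] Q])
  have K0: "0 \<in> K" using assms(1) by auto
  show ?thesis
  proof
    assume reg: "regular_pencil ?E ?A"
    define p where "p = Determinant.det (pencil ?E ?A)"
    have "p \<noteq> 0" using reg by (simp add: regular_pencil_def p_def)
    then have "finite ({s. poly p s = 0} \<union> spectrum (J * Q))"
      using poly_roots_finite card_finite_spectrum(1)[OF JQ] by blast
    then obtain \<omega> where \<omega>: "poly p (?s \<omega>) \<noteq> 0" "?s \<omega> \<notin> spectrum (J * Q)"
      using ex_imaginary_axis_avoiding_finite by blast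
    \<comment> \<open>The kernel at \<open>i \<omega>\<close> is trivial; the vectors needed are \<open>(0, y, u)\<close> with \<open>R Q y = 0\<close> and
      \<open>S u = 0\<close>, for which the second and third kernel equations hold automatically.\<close>
    have triv: "y = 0\<^sub>v n \<and> u = 0\<^sub>v m"
      if yu: "y \<in> carrier_vec n" "u \<in> carrier_vec m" and RQy: "(R * Q) *\<^sub>v y = 0\<^sub>v n"
        and Su: "S *\<^sub>v u = 0\<^sub>v m" and eq: "?s \<omega> \<cdot>\<^sub>v y = (J * Q) *\<^sub>v y + B *\<^sub>v u" for y u
    proof -
      have Wy: "((J - R) * Q) *\<^sub>v y = (J * Q) *\<^sub>v y"
      proof -
        have "(J - R) * Q = J * Q - R * Q" using J R Q by (rule minus_mult_distrib_mat)
        then show ?thesis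
          using minus_mult_distrib_mat_vec[OF JQ RQ yu(1)] RQy mult_mat_vec_carrier[OF JQ yu(1)]
          by simp
      qed
      have QRQy: "(Q * R * Q) *\<^sub>v y = 0\<^sub>v n"
        using assoc_mult_mat[OF Q R Q] assoc_mult_mat_vec[OF Q RQ yu(1)] RQy Q
        by (auto intro!: eq_vecI)
      have "?P (?s \<omega>) *\<^sub>v (0\<^sub>v n @\<^sub>v y @\<^sub>v u) = 0\<^sub>v ?N"
        unfolding pencil_kernel_iff[OF J R Q B S zero_carrier_vec yu] Wy QRQy Su
        using eq mat_mult_zero_vec[OF mat_adjoint_carrier[OF W]] mat_mult_zero_vec[OF mat_adjoint_carrier[OF B]]
        by (auto intro!: eq_vecI)
      moreover have "0\<^sub>v n @\<^sub>v y @\<^sub>v u \<in> carrier_vec ?N" using yu by auto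
      ultimately have "0\<^sub>v n @\<^sub>v y @\<^sub>v u = 0\<^sub>v ?N"
        using det_0_iff_vec_prod_zero[OF P] \<omega>(1) det unfolding p_def by metis
      also have "0\<^sub>v ?N = 0\<^sub>v n @\<^sub>v 0\<^sub>v n @\<^sub>v (0\<^sub>v m :: complex vec)" by (intro eq_vecI) auto
      finally have "y @\<^sub>v u = 0\<^sub>v n @\<^sub>v 0\<^sub>v m" by (subst (asm) append_vec_eq[of _ n]) auto
      then show ?thesis using yu by (subst (asm) append_vec_eq[of _ n]) auto
    qed
    show "\<exists>\<omega>. ?s \<omega> \<notin> spectrum (J * Q) \<and>
       (\<lambda>v. B *\<^sub>v v) ` mat_kernel S \<inter>
         (\<lambda>v. (J * Q - ?s \<omega> \<cdot>\<^sub>m 1\<^sub>m n) *\<^sub>v v) ` mat_kernel (R * Q) = {0\<^sub>v n} \<and>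
       ker_over K B \<inter> ker_over K S = {0\<^sub>v m}"
    proof (intro exI conjI)
      show "?s \<omega> \<notin> spectrum (J * Q)" by fact
      show "(\<lambda>v. B *\<^sub>v v) ` mat_kernel S \<inter>
         (\<lambda>v. (J * Q - ?s \<omega> \<cdot>\<^sub>m 1\<^sub>m n) *\<^sub>v v) ` mat_kernel (R * Q) = {0\<^sub>v n}" (is "?L \<inter> ?M = _")
      proof (intro equalityI subsetI)
        fix v assume "v \<in> ?L \<inter> ?M"
        then obtain u y where u: "u \<in> carrier_vec m" "S *\<^sub>v u = 0\<^sub>v m" "v = B *\<^sub>v u"
          and y: "y \<in> carrier_vec n" "(R * Q) *\<^sub>v y = 0\<^sub>v n" "v = (J * Q) *\<^sub>v y - ?s \<omega> \<cdot>\<^sub>v y"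
          unfolding kerS kerRQ using shift by auto
        have Bu: "B *\<^sub>v (- u) = - v" "S *\<^sub>v (- u) = 0\<^sub>v m"
          using u mat_mult_uminus_vec[OF B u(1)] mat_mult_uminus_vec[OF S u(1)] by auto
        have "?s \<omega> \<cdot>\<^sub>v y = (J * Q) *\<^sub>v y + B *\<^sub>v (- u)"
          unfolding Bu y(3) using y(1) mult_mat_vec_carrier[OF JQ y(1)] by (auto intro!: eq_vecI)
        then have "y = 0\<^sub>v n" using triv[OF y(1) _ y(2) Bu(2)] u(1) by simp
        then have "v = 0\<^sub>v n" using y(3) by (simp add: mat_mult_zero_vec[OF JQ]) auto
        then show "v \<in> {0\<^sub>v n}" by simp
      next
        fix v assume "v \<in> {0\<^sub>v n :: complex vec}"
        moreover have "0\<^sub>v m \<in> mat_kernel S" "0\<^sub>v n \<in> mat_kernel (R * Q)"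
          unfolding kerS kerRQ by (simp_all add: mat_mult_zero_vec[OF S] mat_mult_zero_vec[OF RQ])
        moreover have "B *\<^sub>v 0\<^sub>v m = 0\<^sub>v n" "(J * Q - ?s \<omega> \<cdot>\<^sub>m 1\<^sub>m n) *\<^sub>v 0\<^sub>v n = 0\<^sub>v n"
          by (auto simp: shift mat_mult_zero_vec[OF B] mat_mult_zero_vec[OF JQ])
        ultimately show "v \<in> ?L \<inter> ?M" by (metis IntI image_eqI singletonD)
      qed
      show "ker_over K B \<inter> ker_over K S = {0\<^sub>v m}"
      proof (intro equalityI subsetI)
        fix u assume "u \<in> ker_over K B \<inter> ker_over K S"
        then have u: "u \<in> carrier_vec m" "B *\<^sub>v u = 0\<^sub>v n" "S *\<^sub>v u = 0\<^sub>v m"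
          using B S by (auto simp: ker_over_def mat_kernel_def)
        have "(R * Q) *\<^sub>v 0\<^sub>v n = 0\<^sub>v n" "?s \<omega> \<cdot>\<^sub>v 0\<^sub>v n = (J * Q) *\<^sub>v 0\<^sub>v n + B *\<^sub>v u"
          using u(2) by (auto simp: mat_mult_zero_vec[OF RQ] mat_mult_zero_vec[OF JQ])
        then show "u \<in> {0\<^sub>v m}" using triv[of "0\<^sub>v n" u] u by simp
      next
        fix u assume "u \<in> {0\<^sub>v m :: complex vec}"
        moreover have "0\<^sub>v m \<in> vec_over K m" using K0 by (auto simp: vec_over_def vec_set_def)
        moreover have "B *\<^sub>v 0\<^sub>v m = 0\<^sub>v n" "S *\<^sub>v 0\<^sub>v m = 0\<^sub>v m"
          by (rule mat_mult_zero_vec[OF B], rule mat_mult_zero_vec[OF S])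
        ultimately show "u \<in> ker_over K B \<inter> ker_over K S"
          using B S by (auto simp: ker_over_def mat_kernel_def)
      qed
    qed
  next
    assume "\<exists>\<omega>. ?s \<omega> \<notin> spectrum (J * Q) \<and>
       (\<lambda>v. B *\<^sub>v v) ` mat_kernel S \<inter>
         (\<lambda>v. (J * Q - ?s \<omega> \<cdot>\<^sub>m 1\<^sub>m n) *\<^sub>v v) ` mat_kernel (R * Q) = {0\<^sub>v n} \<and>
       ker_over K B \<inter> ker_over K S = {0\<^sub>v m}"
    then obtain \<omega> where spec: "?s \<omega> \<notin> spectrum (J * Q)"
      and int: "(\<lambda>v. B *\<^sub>v v) ` mat_kernel S \<inter>
         (\<lambda>v. (J * Q - ?s \<omega> \<cdot>\<^sub>m 1\<^sub>m n) *\<^sub>v v) ` mat_kernel (R * Q) = {0\<^sub>v n}"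
      and BS: "ker_over K B \<inter> ker_over K S = {0\<^sub>v m}" by blast
    have spec': "z = 0\<^sub>v n" if "z \<in> carrier_vec n" "(J * Q) *\<^sub>v z = ?s \<omega> \<cdot>\<^sub>v z" for z
      using spec that J by (auto simp: spectrum_def eigenvalue_def eigenvector_def)
    have int': "B *\<^sub>v u = 0\<^sub>v n"
      if u: "u \<in> carrier_vec m" and y: "y \<in> carrier_vec n" and Su: "S *\<^sub>v u = 0\<^sub>v m"
        and RQy: "(R * Q) *\<^sub>v y = 0\<^sub>v n" and eq: "(J * Q) *\<^sub>v y + B *\<^sub>v u = ?s \<omega> \<cdot>\<^sub>v y" for u y
    proof -
      note Bu = mult_mat_vec_carrier[OF B u] and JQy = mult_mat_vec_carrier[OF JQ y]
      have "- (B *\<^sub>v u) = B *\<^sub>v (- u)" "- u \<in> mat_kernel S"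
        using u Su mat_mult_uminus_vec[OF B u] mat_mult_uminus_vec[OF S u] by (auto simp: kerS)
      then have "- (B *\<^sub>v u) \<in> (\<lambda>v. B *\<^sub>v v) ` mat_kernel S" by blast
      moreover have "- (B *\<^sub>v u) = (J * Q - ?s \<omega> \<cdot>\<^sub>m 1\<^sub>m n) *\<^sub>v y"
        unfolding shift[OF y] eq[symmetric] using Bu JQy
        by (intro eq_vecI) (auto simp del: index_mult_mat_vec)
      moreover have "y \<in> mat_kernel (R * Q)" using y RQy by (simp add: kerRQ)
      ultimately have "- (B *\<^sub>v u) \<in> {0\<^sub>v n}" using int by blast
      then show ?thesis using Bu by (metis singletonD uminus_uminus_vec uminus_zero_vec)
    qed
    note BS' = common_kernel_trivial_complexification[OF assms(1) over(4) assms(5) BS]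
    have "Determinant.det (?P (?s \<omega>)) \<noteq> 0"
    proof
      assume "Determinant.det (?P (?s \<omega>)) = 0"
      then obtain v where v: "v \<in> carrier_vec ?N" "v \<noteq> 0\<^sub>v ?N" "?P (?s \<omega>) *\<^sub>v v = 0\<^sub>v ?N"
        using det_0_iff_vec_prod_zero[OF P] by auto
      define x where "x = vec_first v n"
      define y where "y = vec_first (vec_last v (n + m)) n"
      define u where "u = vec_last (vec_last v (n + m)) m"
      have xyu: "x \<in> carrier_vec n" "y \<in> carrier_vec n" "u \<in> carrier_vec m"
        by (auto simp: x_def y_def u_def)
      have "v = x @\<^sub>v y @\<^sub>v u"
        unfolding x_def y_def u_def
        by (metis vec_first_last_append v(1) vec_last_carrier)
      then have ker: "?P (?s \<omega>) *\<^sub>v (x @\<^sub>v y @\<^sub>v u) = 0\<^sub>v ?N" using v(3) by simp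
      have "x = 0\<^sub>v n \<and> y = 0\<^sub>v n \<and> u = 0\<^sub>v m"
        by (rule pencil_kernel_trivial[OF J R Q B S skew Rsym Qsym assms(6) Rpsd Spsd spec' int'
              BS' xyu])
          (use ker[unfolded pencil_kernel_iff[OF J R Q B S xyu]] in blast)+
      then have "v = 0\<^sub>v ?N" using \<open>v = x @\<^sub>v y @\<^sub>v u\<close> by (auto intro!: eq_vecI)
      then show False using v(2) by simp
    qed
    then show "regular_pencil ?E ?A" unfolding regular_pencil_def using det[of "?s \<omega>"] by force
  qed
qed

end
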